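(* Let $\Lambda$ be a finite nonempty set and let $\mathcal{F}=\{f_\lambda : \lambda\in\Lambda\}\subseteq \mathrm{Diff}^1(\mathbb{R})$ be an iterated function system on $\mathbb{R}$. If $\mathcal{F}$ is structurally stable, then for every $\lambda\in\Lambda$ every fixed point $p$ of $f_\lambda$ is hyperbolic, i.e. $|f_\lambda'(p)|\neq 1$.
   Context: An iterated function system (IFS) on $M$ is a family $\{f_\lambda:M\to M : \lambda\in\Lambda\}$ of continuous maps with $\Lambda$ a finite nonempty set. $\mathrm{Diff}^1(M)$ is the set of $C^1$-diffeomorphisms of $M$. The following definitions are given for a smooth manifold $M$ with Riemannian metric (distance) $r$, and are applied here with $M=\mathbb{R}$ and $r(x,y)=|x-y|$. For homeomorphisms $f,g$ of $M$, $\rho_0(f,g)=\max\{r(f(x),g(x)),\, r(f^{-1}(x),g^{-1}(x)) : x\in M\}$. For $f,g\in \mathrm{Diff}^1(M)$, $\rho_1(f,g)=\rho_0(f,g)+\max\{\|Df(x)-Dg(x)\| : x\in M\}$, where $\max\{\|Df(x)-Dg(x)\| : x\in M\}=\max\{|Df(x)u-Dg(x)u| : x\in M,\ u\in T_xM,\ |u|=1\}$. (On $\mathbb{R}$ the maxima are read as suprema, possibly $+\infty$.) For IFSs $\mathcal{F}=\{f_\lambda:\lambda\in\Lambda\}$ and $\mathcal{G}=\{g_\lambda:\lambda\in\Lambda\}$ contained in $\mathrm{Diff}^1(M)$, put $\mathcal{D}_1(\mathcal{F},\mathcal{G})=0$ if $\mathcal{F}=\mathcal{G}$, and otherwise $\mathcal{D}_1(\mathcal{F},\mathcal{G})=\max\{\rho_1(f_{\lambda},g_{\mu})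 : f_{\lambda}\in\mathcal{F},\ g_{\mu}\in\mathcal{G}\}$, the maximum being over all pairs $\lambda,\mu\in\Lambda$. For $\sigma=\{\ldots,\lambda_{-1},\lambda_0,\lambda_1,\ldots\}\in\Lambda^{\mathbb{Z}}$ and $n\ge 1$ put $F_{\sigma_n}=f_{\lambda_n}\circ f_{\lambda_{n-1}}\circ\cdots\circ f_{\lambda_1}$; also $F_{\sigma_0}=\mathrm{id}$ and $F_{\sigma_{-n}}=f_{\lambda_{-n}}^{-1}\circ\cdots\circ f_{\lambda_{-1}}^{-1}$; similarly $G_{\sigma_n}$ for $\mathcal{G}$. $\mathcal{F}=\{f_\lambda:\lambda\in\Lambda\}\subseteq \mathrm{Diff}^1(M)$ is structurally stable if for every $\epsilon>0$ there is $\delta>0$ such that for every IFS $\mathcal{G}=\{g_\lambda:\lambda\in\Lambda\}\subseteq\mathrm{Diff}^1(M)$ with $\mathcal{D}_1(\mathcal{F},\mathcal{G})<\delta$, for every $\sigma\in\Lambda^{\mathbb{Z}}$ and every $n\in\mathbb{Z}$ there is a homeomorphism $h:M\to M$ with (i) $F_{\sigma_n}\circ h=h\circ G_{\sigma_n}$ and (ii) $r(x,h(x))<\epsilon$ for all $x\in M$. *)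

theory Defs
  imports "HOL-Analysis.Analysis"
begin

definition Diff1 :: "(real \<Rightarrow> real) set" where
  "Diff1 = {f. bij f \<and> f C1_differentiable_on UNIV \<and> inv f C1_differentiable_on UNIV}"

(* The real line is not compact, so the maxima over all points are suprema in ereal. *)

definition rho0 :: "('a::metric_space \<Rightarrow> 'a) \<Rightarrow> ('a \<Rightarrow> 'a) \<Rightarrow> ereal" where
  "rho0 f g = (SUP x. ereal (max (dist (f x) (g x)) (dist (inv f x) (inv g x))))"

(* The unit tangent vectors at x are 1 and -1, so the norm of Df(x) - Dg(x) is
   the absolute value of the difference of the derivatives. *)

definition rho1 :: "(real \<Rightarrow> real) \<Rightarrow> (real \<Rightarrow> real) \<Rightarrow> ereal" where
  "rho1 f g = rho0 f g + (SUP x. ereal \<bar>deriv f x - deriv g x\<bar>)"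

(* The distance is defined on sets of maps, so the case F = G is equality of sets.
   A relabelling of an iterated function system by a permutation of its indices
   therefore has distance 0 from it.  The maximum runs over all pairs of maps,
   not only over pairs with the same index. *)

definition D1 :: "(real \<Rightarrow> real) set \<Rightarrow> (real \<Rightarrow> real) set \<Rightarrow> ereal" where
  "D1 F G = (if F = G then 0 else Max {rho1 f g | f g. f \<in> F \<and> g \<in> G})"

definition diff1_ifs :: "'l set \<Rightarrow> ('l \<Rightarrow> real \<Rightarrow> real) \<Rightarrow> bool" where
  "diff1_ifs \<Lambda> f \<longleftrightarrow> finite \<Lambda> \<and> \<Lambda> \<noteq> {} \<and> (\<forall>l\<in>\<Lambda>. f l \<in> Diff1)"

primrec fwd_comp :: "('l \<Rightarrow> 'a \<Rightarrow> 'a) \<Rightarrow> (int \<Rightarrow> 'l) \<Rightarrow> nat \<Rightarrow> 'a \<Rightarrow> 'a" where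
  "fwd_comp f \<sigma> 0 = id"
| "fwd_comp f \<sigma> (Suc n) = f (\<sigma> (int (Suc n))) \<circ> fwd_comp f \<sigma> n"

primrec bwd_comp :: "('l \<Rightarrow> 'a \<Rightarrow> 'a) \<Rightarrow> (int \<Rightarrow> 'l) \<Rightarrow> nat \<Rightarrow> 'a \<Rightarrow> 'a" where
  "bwd_comp f \<sigma> 0 = id"
| "bwd_comp f \<sigma> (Suc n) = inv (f (\<sigma> (- int (Suc n)))) \<circ> bwd_comp f \<sigma> n"

(* The index 0 of the sequence is never used: position n > 0 contributes a map,
   position n < 0 an inverse map. *)

definition ifs_comp :: "('l \<Rightarrow> 'a \<Rightarrow> 'a) \<Rightarrow> (int \<Rightarrow> 'l) \<Rightarrow> int \<Rightarrow> 'a \<Rightarrow> 'a" where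
  "ifs_comp f \<sigma> n = (if 0 \<le> n then fwd_comp f \<sigma> (nat n) else bwd_comp f \<sigma> (nat (- n)))"

definition structurally_stable :: "'l set \<Rightarrow> ('l \<Rightarrow> real \<Rightarrow> real) \<Rightarrow> bool" where
  "structurally_stable \<Lambda> f \<longleftrightarrow>
     (\<forall>\<epsilon>>0. \<exists>\<delta>>0. \<forall>g. diff1_ifs \<Lambda> g \<and> D1 (f ` \<Lambda>) (g ` \<Lambda>) < ereal \<delta> \<longrightarrow>
        (\<forall>\<sigma>. range \<sigma> \<subseteq> \<Lambda> \<longrightarrow>
          (\<forall>n. \<exists>h k. homeomorphism UNIV UNIV h k \<and>
                 ifs_comp f \<sigma> n \<circ> h = h \<circ> ifs_comp g \<sigma> n \<and>
                 (\<forall>x. dist x (h x) < \<epsilon>))))"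

definition hyperbolic_fixed_point :: "(real \<Rightarrow> real) \<Rightarrow> real \<Rightarrow> bool" where
  "hyperbolic_fixed_point f p \<longleftrightarrow> f p = p \<and> \<bar>deriv f p\<bar> \<noteq> 1"

end

theory Submission
  imports Defs
begin

text \<open>
  Since \<open>D1\<close> only sees the sets of maps, a swap of two labels is a perturbation of size \<open>0\<close>;
  conjugacies tending to the identity then force all maps of a stable system to coincide with a
  single map \<open>F\<close>. Let \<open>F p = p\<close> and \<open>F' p = s\<close> with \<open>s = \<plusminus>1\<close>. Replacing \<open>F\<close> near \<open>p\<close> by
  the affine involution or identity \<open>x \<mapsto> p + s (x - p)\<close> is a small perturbation, so, by
  stability, \<open>F \<circ> F\<close> is the identity on some open interval. But adding a small bump to \<open>F\<close>
  at a point \<open>m\<close> of that interval yields \<open>G\<close> with \<open>G (G m) \<noteq> m\<close>, while a conjugacy close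
  to the identity would force \<open>G (G m) = m\<close>.
\<close>

subsection \<open>Diffeomorphisms of the line\<close>

lemma Diff1_has_derivative:
  assumes "F \<in> Diff1"
  shows "(F has_real_derivative deriv F x) (at x)"
proof -
  obtain D where "(F has_real_derivative D x) (at x)"
    using assms
    by (auto simp: Diff1_def C1_differentiable_on_def has_real_derivative_iff_has_vector_derivative)
  then show ?thesis
    using DERIV_imp_deriv by fastforce
qed

lemma Diff1_isCont_deriv:
  assumes "F \<in> Diff1"
  shows "isCont (deriv F) x"
proof -
  obtain D where D: "\<And>x. (F has_vector_derivative D x) (at x)" and "continuous_on UNIV D"
    using assms by (auto simp: Diff1_def C1_differentiable_on_def)
  moreover have "deriv F = D"
    using D by (auto intro!: DERIV_imp_deriv simp: has_real_derivative_iff_has_vector_derivative)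
  ultimately show ?thesis
    by (simp add: continuous_on_eq_continuous_at)
qed

lemma Diff1_isCont: "F \<in> Diff1 \<Longrightarrow> isCont F x"
  using DERIV_isCont Diff1_has_derivative by blast

lemma Diff1_bij: "F \<in> Diff1 \<Longrightarrow> bij F"
  by (simp add: Diff1_def)

text \<open>The chain rule applied to \<open>inv F (F x) = x\<close> would give the identity the
  derivative 0.\<close>

lemma Diff1_deriv_nonzero:
  assumes "F \<in> Diff1"
  shows "deriv F x \<noteq> 0"
proof
  assume 0: "deriv F x = 0"
  obtain D where D: "\<And>x. (inv F has_real_derivative D x) (at x)"
    using assms
    by (auto simp: Diff1_def C1_differentiable_on_def has_real_derivative_iff_has_vector_derivative)
  have "((\<lambda>x. inv F (F x)) has_real_derivative D (F x) * deriv F x) (at x)"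
    using D Diff1_has_derivative[OF assms] by (rule DERIV_chain2)
  moreover have "(\<lambda>x. inv F (F x)) = (\<lambda>x. x)"
    using Diff1_bij[OF assms] by (simp add: bij_is_inj)
  ultimately have "((\<lambda>x. x) has_real_derivative 0) (at x)"
    using 0 by simp
  then show False
    using DERIV_ident DERIV_unique by fastforce
qed

text \<open>Rolle's theorem turns the nonvanishing derivative into injectivity; the inverse function
  theorem then gives \<open>inv G\<close> the derivative \<open>inverse (G' (inv G y))\<close>,
  continuous as a composition. Surjectivity is assumed because a nonvanishing derivative does not
  yield it.\<close>

lemma Diff1_I:
  assumes G: "\<And>x. (G has_real_derivative G' x) (at x)" and G': "continuous_on UNIV G'"
    and nz: "\<And>x. G' x \<noteq> 0" and "surj G"
  shows "G \<in> Diff1"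
proof -
  have "inj G"
  proof (rule injI, rule ccontr)
    have aux: "G a \<noteq> G b" if "a < b" for a b
    proof
      assume eq: "G a = G b"
      have "\<exists>z>a. z < b \<and> DERIV G z :> 0"
        using DERIV_isCont[OF G] G Rolle[OF that eq]
        by (meson continuous_at_imp_continuous_on real_differentiable_def)
      then show False
        using G nz DERIV_unique by metis
    qed
    fix x y assume "G x = G y" "x \<noteq> y"
    then show False
      using aux[of x y] aux[of y x] by linarith
  qed
  then have bij: "bij G"
    using \<open>surj G\<close> by (simp add: bij_def)
  have isCont_inv: "isCont (inv G) y" for y
  proof -
    have "isCont (inv G) (G (inv G y))"
      by (rule isCont_inverse_function[where d=1 and f=G and g="inv G"])
        (use \<open>inj G\<close> DERIV_isCont[OF G] in auto)
    then show ?thesis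
      using \<open>surj G\<close> by (simp add: surj_f_inv_f)
  qed
  then have cont: "continuous_on UNIV (inv G)"
    by (simp add: continuous_at_imp_continuous_on)
  have inv: "(inv G has_real_derivative inverse (G' (inv G y))) (at y)" for y
    by (rule DERIV_inverse_function[where f=G and a="y-1" and b="y+1"])
      (use G nz isCont_inv \<open>surj G\<close> in \<open>simp_all add: surj_f_inv_f\<close>)
  have "continuous_on UNIV (\<lambda>y. inverse (G' (inv G y)))"
    using nz by (intro continuous_on_inverse continuous_on_compose2[OF G' cont]) auto
  then have "inv G C1_differentiable_on UNIV"
    using inv unfolding C1_differentiable_on_def has_real_derivative_iff_has_vector_derivative
    by (intro exI[of _ "\<lambda>y. inverse (G' (inv G y))"]) simp
  moreover have "G C1_differentiable_on UNIV"
    using G G' unfolding C1_differentiable_on_def has_real_derivative_iff_has_vector_derivative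
    by (intro exI[of _ G']) simp
  ultimately show ?thesis
    using bij by (simp add: Diff1_def)
qed

text \<open>The common tool for both perturbations below. The two summands of \<open>rho1\<close>
  are each at most \<open>e\<close>. The inverses are compared through the support of
  \<open>u\<close>, without any estimate on how fast they vary.\<close>

lemma Diff1_perturbation:
  fixes u :: "real \<Rightarrow> real"
  assumes F: "F \<in> Diff1"
    and u: "\<And>x. (u has_real_derivative u' x) (at x)" and u': "continuous_on UNIV u'"
    and supp: "\<And>x. r < \<bar>x - c\<bar> \<Longrightarrow> u x = 0"
    and bounds: "\<And>x. \<bar>u x\<bar> \<le> e" "\<And>x. \<bar>u' x\<bar> \<le> e" "2 * r \<le> e"
    and nz: "\<And>x. deriv F x + u' x \<noteq> 0"
  shows "(\<lambda>x. F x + u x) \<in> Diff1" and "rho1 F (\<lambda>x. F x + u x) \<le> ereal (2 * e)"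
proof -
  let ?G = "\<lambda>x. F x + u x"
  have G: "(?G has_real_derivative deriv F x + u' x) (at x)" for x
    by (intro DERIV_add Diff1_has_derivative F u)
  have surj: "surj ?G"
  proof -
    have "\<exists>x. ?G x = y" for y
    proof -
      \<comment> \<open>Since \<open>u\<close> shifts values by at most \<open>e\<close>, the new
        map is at most \<open>y\<close> at \<open>a\<close> and at least \<open>y\<close> at
        \<open>b\<close>; the intermediate value property does the rest.\<close>
      obtain a b where ab: "F a = y - e" "F b = y + e"
        using Diff1_bij[OF F] by (metis bij_pointE)
      have "?G a \<le> y" "y \<le> ?G b"
        using ab bounds(1)[of a] bounds(1)[of b] by linarith+
      moreover have "continuous_on UNIV ?G"
        using DERIV_isCont[OF G] by (simp add: continuous_at_imp_continuous_on)
      ultimately have "y \<in> range ?G"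
        using connected_continuous_image[of UNIV ?G]
        by (meson connected_UNIV connectedD_interval rangeI)
      then show ?thesis
        by auto
    qed
    then show ?thesis
      unfolding surj_def by metis
  qed
  show G1: "?G \<in> Diff1"
  proof (rule Diff1_I[OF G _ nz surj])
    show "continuous_on UNIV (\<lambda>x. deriv F x + u' x)"
      using Diff1_isCont_deriv[OF F]
      by (intro continuous_on_add u') (simp add: continuous_at_imp_continuous_on)
  qed
  have inv: "\<bar>inv F y - inv ?G y\<bar> \<le> e" for y
  proof -
    define v w where "v = inv F y" and "w = inv ?G y"
    have vw: "F v = y" "F w + u w = y"
      using Diff1_bij[OF F] surj surj_f_inv_f[of ?G y]
      by (auto simp: v_def w_def bij_is_surj surj_f_inv_f)
    \<comment> \<open>If \<open>v\<close> or \<open>w\<close> lies off the support of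
      \<open>u\<close>, the two maps agree there and injectivity gives \<open>v = w\<close>.
      Otherwise both lie in an interval of length \<open>2 * r\<close>, which is at most
      \<open>e\<close>.\<close>
    have "\<bar>v - w\<bar> \<le> e"
    proof (cases "r < \<bar>v - c\<bar> \<or> r < \<bar>w - c\<bar>")
      case True
      then have "v = w"
      proof
        assume "r < \<bar>v - c\<bar>"
        then have "?G v = ?G w"
          using vw supp by simp
        then show ?thesis
          using Diff1_bij[OF G1] by (metis (no_types, lifting) bij_pointE)
      next
        assume "r < \<bar>w - c\<bar>"
        then have "F v = F w"
          using vw supp by simp
        then show ?thesis
          using Diff1_bij[OF F] by (metis bij_pointE)
      qed
      then show ?thesis
        using bounds(1)[of 0] by simp
    next
      case False
      then show ?thesis
        using bounds(3) by linarith
    qed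
    then show ?thesis
      by (simp add: v_def w_def)
  qed
  have "rho0 F ?G \<le> ereal e"
    unfolding rho0_def using bounds(1) inv by (intro SUP_least) (simp add: dist_real_def)
  moreover have "deriv ?G x = deriv F x + u' x" for x
    by (rule DERIV_imp_deriv[OF G])
  then have "(SUP x. ereal \<bar>deriv F x - deriv ?G x\<bar>) \<le> ereal e"
    using bounds(2) by (intro SUP_least) simp
  ultimately have "rho1 F ?G \<le> ereal e + ereal e"
    unfolding rho1_def by (rule add_mono)
  then show "rho1 F ?G \<le> ereal (2 * e)"
    by simp
qed

subsection \<open>A plateau function\<close>

text \<open>This function is the square of the positive part, the C1 building block of the plateau.
  At 0 Caratheodory's criterion applies with difference quotient \<open>max 0 y\<close>.\<close>

lemma DERIV_mult_max_0:
  fixes x :: real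
  shows "((\<lambda>y. y * max 0 y) has_real_derivative 2 * max 0 x) (at x)"
proof -
  consider "x < 0" | "x = 0" | "0 < x"
    by linarith
  then show ?thesis
  proof cases
    case 1
    have "((\<lambda>y. 0) has_real_derivative 2 * max 0 x) (at x)"
      using 1 by simp
    then show ?thesis
      by (rule has_field_derivative_transform_within_open[where S="{..<0}"]) (use 1 in auto)
  next
    case 2
    have "isCont (\<lambda>y::real. max 0 y) 0"
      by (intro continuous_intros)
    then have "((\<lambda>y. y * max 0 y) has_real_derivative 0) (at (0::real))"
      unfolding CARAT_DERIV by (intro exI[of _ "\<lambda>y. max 0 y"]) auto
    then show ?thesis
      using 2 by simp
  next
    case 3
    have "((\<lambda>y. y * y) has_real_derivative 2 * max 0 x) (at x)"
      using 3 by (auto intro!: derivative_eq_intros)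
    then show ?thesis
      by (rule has_field_derivative_transform_within_open[where S="{0<..}"]) (use 3 in auto)
  qed
qed

lemma plateau_exists:
  obtains \<phi> \<phi>' :: "real \<Rightarrow> real" and C :: real
  where "\<And>x. (\<phi> has_real_derivative \<phi>' x) (at x)" "continuous_on UNIV \<phi>'"
    "\<And>x. 0 \<le> \<phi> x" "\<And>x. \<phi> x \<le> 1" "\<And>x. \<bar>\<phi>' x\<bar> \<le> C" "0 < C"
    "\<And>x. 1 \<le> \<bar>x\<bar> \<Longrightarrow> \<phi> x = 0" "\<And>x. 1 \<le> \<bar>x\<bar> \<Longrightarrow> \<phi>' x = 0"
    "\<And>x. \<bar>x\<bar> \<le> 1/2 \<Longrightarrow> \<phi> x = 1"
proof -
  define b where "b = (\<lambda>y::real. y * max 0 y)"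
  \<comment> \<open>For \<open>1 \<le> \<bar>x\<bar>\<close> the inner \<open>b\<close> is 0 and the
    outer one is \<open>b 1 = 1\<close>, so \<phi> is 0. For \<open>\<bar>x\<bar> \<le> 1/2\<close>
    the inner \<open>b\<close> is at least 1/4, so the outer argument is nonpositive and \<phi> is
    1.\<close>
  define \<phi> where "\<phi> = (\<lambda>x. 1 - b (1 - 4 * b (1 - x * x)))"
  define \<phi>' where
    "\<phi>' = (\<lambda>x. - (2 * max 0 (1 - 4 * b (1 - x * x)) * (- 4 * (2 * max 0 (1 - x * x) * (- 2 * x)))))"
  have b: "(b has_real_derivative 2 * max 0 x) (at x)" for x
    unfolding b_def by (rule DERIV_mult_max_0)
  have b_nonneg: "0 \<le> b y" for y
    by (cases "y \<le> 0") (auto simp: b_def)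
  have b_nonpos: "b y = 0" if "y \<le> 0" for y
    using that by (simp add: b_def)
  have b_le: "b y \<le> 1" if "y \<le> 1" for y
  proof (cases "y \<le> 0")
    case False
    then show ?thesis
      using that by (simp add: b_def mult_le_one)
  qed (simp add: b_nonpos)
  have deriv: "(\<phi> has_real_derivative \<phi>' x) (at x)" for x
    unfolding \<phi>_def \<phi>'_def by (auto intro!: derivative_eq_intros DERIV_chain2[OF b])
  have "continuous_on UNIV b"
    unfolding b_def by (intro continuous_intros)
  moreover have "continuous_on UNIV (\<lambda>x::real. 1 - x * x)"
    by (intro continuous_intros)
  ultimately have "continuous_on UNIV (\<lambda>x. b (1 - x * x))"
    by (rule continuous_on_compose2) simp
  then have cont: "continuous_on UNIV \<phi>'"
    unfolding \<phi>'_def by (intro continuous_intros)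
  have sq: "1 \<le> x * x" if "1 \<le> \<bar>x\<bar>" for x :: real
    using mult_mono[OF that that] by (simp add: abs_mult_self_eq)
  have zero: "\<phi> x = 0" "\<phi>' x = 0" if "1 \<le> \<bar>x\<bar>" for x
    using sq[OF that] by (auto simp: \<phi>_def \<phi>'_def b_nonpos) (simp add: b_def)
  have one: "\<phi> x = 1" if "\<bar>x\<bar> \<le> 1/2" for x
  proof -
    have "x * x \<le> 1/4"
      using mult_mono[OF that that] by simp
    then have "1/2 * (1/2) \<le> (1 - x * x) * (1 - x * x)"
      by (intro mult_mono) auto
    then have "1 - 4 * b (1 - x * x) \<le> 0"
      using \<open>x * x \<le> 1/4\<close> by (simp add: b_def)
    then show ?thesis
      by (simp add: \<phi>_def b_nonpos)
  qed
  have range: "0 \<le> \<phi> x" "\<phi> x \<le> 1" for x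
    using b_nonneg b_le by (auto simp: \<phi>_def)
  \<comment> \<open>\<phi>' vanishes outside [-1, 1], so a bound on this compact interval is a
    global one.\<close>
  have "compact (\<phi>' ` {-1..1})"
    using cont by (intro compact_continuous_image) (auto intro: continuous_on_subset)
  then obtain C where C: "0 < C" "\<And>x. x \<in> {-1..1} \<Longrightarrow> \<bar>\<phi>' x\<bar> \<le> C"
    by (force dest!: compact_imp_bounded simp: bounded_pos)
  have bound: "\<bar>\<phi>' x\<bar> \<le> C" for x
  proof (cases "\<bar>x\<bar> \<le> 1")
    case False
    then show ?thesis
      using zero(2)[of x] C(1) by simp
  qed (use C(2)[of x] in \<open>simp add: abs_le_iff\<close>)
  show ?thesis
    by (rule that[OF deriv cont range bound C(1) zero one])
qed

subsection \<open>Two perturbations\<close>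

text \<open>The affine map minus \<open>F\<close> vanishes at \<open>p\<close> and has small
  derivative nearby, so it is at most \<theta> times r on radius r. This factor r absorbs the slope
  C / r of a cutoff at that scale, and the product stays C1-small.\<close>

lemma affine_perturbation:
  assumes F: "F \<in> Diff1" and "F p = p" and s: "\<bar>deriv F p\<bar> = 1" and "0 < \<delta>"
  obtains G r where "G \<in> Diff1" "rho1 F G < ereal \<delta>" "0 < r"
    "\<And>x. \<bar>x - p\<bar> \<le> r \<Longrightarrow> G (G x) = x"
proof -
  obtain \<phi> \<phi>' C where \<phi>: "\<And>x. (\<phi> has_real_derivative \<phi>' x) (at x)" "continuous_on UNIV \<phi>'"
    "\<And>x. 0 \<le> \<phi> x" "\<And>x. \<phi> x \<le> 1" "\<And>x. \<bar>\<phi>' x\<bar> \<le> C" "0 < C"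
    "\<And>x. 1 \<le> \<bar>x\<bar> \<Longrightarrow> \<phi> x = 0" "\<And>x. 1 \<le> \<bar>x\<bar> \<Longrightarrow> \<phi>' x = 0"
    "\<And>x. \<bar>x\<bar> \<le> 1/2 \<Longrightarrow> \<phi> x = 1"
    by (rule plateau_exists) blast
  define s where "s = deriv F p"
  \<comment> \<open>The bound \<delta> / 3 gives \<open>2 * e < \<delta>\<close>. The bound 1/4
    keeps the new derivative nonzero: its distance from \<open>s\<close> is below
    \<open>\<theta> + e\<close>, at most 1/2, while \<open>\<bar>s\<bar> = 1\<close>.\<close>
  define e where "e = min (\<delta> / 3) (1/4)"
  \<comment> \<open>Chosen so that the two terms of the product rule, bounded by C * \<theta> and
    \<theta>, add up to \<open>e\<close>.\<close>
  define \<theta> where "\<theta> = e / (1 + C)"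
  have e: "0 < e" "2 * e < \<delta>" "e \<le> 1/4"
    using \<open>0 < \<delta>\<close> by (auto simp: e_def)
  have \<theta>: "0 < \<theta>" "\<theta> * (1 + C) = e"
    using e(1) \<phi>(6) by (auto simp: \<theta>_def)
  have "\<theta> \<le> e"
    using e(1) \<phi>(6) by (simp add: \<theta>_def field_simps)
  obtain d where d: "0 < d" "\<And>x. \<bar>x - p\<bar> < d \<Longrightarrow> \<bar>deriv F x - s\<bar> < \<theta>"
    using Diff1_isCont_deriv[OF F, of p] \<theta>(1) unfolding continuous_at_eps_delta s_def
    by (auto simp: dist_real_def)
  define r where "r = min (d / 2) (e / 2)"
  have r: "0 < r" "r < d" "2 * r \<le> e" "r \<le> 1"
    using d(1) e by (auto simp: r_def)
  define w where "w = (\<lambda>x. p + s * (x - p) - F x)"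
  have w: "(w has_real_derivative s - deriv F x) (at x)" for x
    unfolding w_def by (auto intro!: derivative_eq_intros Diff1_has_derivative[OF F])
  \<comment> \<open>Mean value estimate from \<open>w p = 0\<close>.\<close>
  have w_bound: "\<bar>w x\<bar> \<le> \<theta> * r" if "\<bar>x - p\<bar> \<le> r" for x
  proof -
    have "norm (w x - w p) \<le> \<theta> * norm (x - p)"
    proof (rule field_differentiable_bound[where S="{p - r..p + r}"])
      show "(w has_field_derivative s - deriv F z) (at z within {p - r..p + r})" for z
        by (rule has_field_derivative_at_within[OF w])
      show "norm (s - deriv F z) \<le> \<theta>" if "z \<in> {p - r..p + r}" for z
        using d(2)[of z] that r(2) by (simp add: abs_less_iff abs_le_iff)
    qed (use that r in auto)
    also have "\<dots> \<le> \<theta> * r"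
      using that \<theta>(1) by simp
    finally show ?thesis
      using \<open>F p = p\<close> by (simp add: w_def)
  qed
  define u where "u = (\<lambda>x. \<phi> ((x - p) / r) * w x)"
  define u' where
    "u' = (\<lambda>x. \<phi>' ((x - p) / r) / r * w x + \<phi> ((x - p) / r) * (s - deriv F x))"
  have far: "1 \<le> \<bar>(x - p) / r\<bar>" if "r < \<bar>x - p\<bar>" for x
    using that r(1) by (simp add: abs_divide)
  have u: "(u has_real_derivative u' x) (at x)" for x
  proof -
    have "((\<lambda>x. (x - p) / r) has_real_derivative 1 / r) (at x)"
      using r(1) by (auto intro!: derivative_eq_intros)
    from DERIV_mult[OF DERIV_chain2[OF \<phi>(1) this] w] show ?thesis
      by (simp add: u_def u'_def mult.commute)
  qed
  have u'_cont: "continuous_on UNIV u'"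
  proof -
    have line: "continuous_on UNIV (\<lambda>x. (x - p) / r)"
      using r(1) by (intro continuous_intros) auto
    have "continuous_on UNIV w"
      using DERIV_isCont[OF w] by (simp add: continuous_at_imp_continuous_on)
    moreover have "continuous_on UNIV \<phi>"
      using DERIV_isCont[OF \<phi>(1)] by (simp add: continuous_at_imp_continuous_on)
    then have "continuous_on UNIV (\<lambda>x. \<phi> ((x - p) / r))"
      using line by (rule continuous_on_compose2) simp
    moreover have "continuous_on UNIV (\<lambda>x. \<phi>' ((x - p) / r))"
      using \<phi>(2) line by (rule continuous_on_compose2) simp
    moreover have "continuous_on UNIV (deriv F)"
      using Diff1_isCont_deriv[OF F] by (simp add: continuous_at_imp_continuous_on)
    ultimately show ?thesis
      unfolding u'_def using r(1) by (intro continuous_intros) auto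
  qed
  have u'_near: "\<bar>u' x\<bar> \<le> e" if "\<bar>x - p\<bar> \<le> r" for x
  proof -
    have "\<bar>\<phi>' ((x - p) / r) / r * w x\<bar> = \<bar>\<phi>' ((x - p) / r)\<bar> * (\<bar>w x\<bar> / r)"
      using r(1) by (simp add: abs_mult abs_divide)
    also have "\<dots> \<le> C * \<theta>"
      using \<phi>(5,6) w_bound[OF that] r(1) by (intro mult_mono) (auto simp: field_simps)
    finally have "\<bar>\<phi>' ((x - p) / r) / r * w x\<bar> \<le> C * \<theta>" .
    moreover have "\<bar>\<phi> ((x - p) / r) * (s - deriv F x)\<bar> \<le> 1 * \<theta>"
      unfolding abs_mult using \<phi>(3,4) d(2)[of x] that r(2) \<theta>(1)
      by (intro mult_mono) (auto simp: abs_minus_commute)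
    moreover have "C * \<theta> + 1 * \<theta> = e"
      using \<theta>(2) by (simp add: algebra_simps)
    ultimately show ?thesis
      unfolding u'_def by linarith
  qed
  have u'_far: "u' x = 0" if "r < \<bar>x - p\<bar>" for x
    using \<phi>(7,8)[OF far[OF that]] by (simp add: u'_def)
  have supp: "u x = 0" if "r < \<bar>x - p\<bar>" for x
    using \<phi>(7)[OF far[OF that]] by (simp add: u_def)
  have u_bound: "\<bar>u x\<bar> \<le> e" for x
  proof (cases "\<bar>x - p\<bar> \<le> r")
    case True
    have "\<bar>u x\<bar> \<le> 1 * (\<theta> * r)"
      unfolding u_def abs_mult using \<phi>(3,4) w_bound[OF True] by (intro mult_mono) auto
    also have "\<dots> \<le> \<theta>"
      using r \<theta>(1) by (simp add: mult_left_le)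
    finally show ?thesis
      using \<open>\<theta> \<le> e\<close> by simp
  qed (use supp e(1) in auto)
  have u'_bound: "\<bar>u' x\<bar> \<le> e" for x
    using u'_near[of x] u'_far[of x] e(1) by (cases "\<bar>x - p\<bar> \<le> r") auto
  have nz: "deriv F x + u' x \<noteq> 0" for x
  proof (cases "\<bar>x - p\<bar> \<le> r")
    case True
    then show ?thesis
      using d(2)[of x] r(2) u'_near[OF True] e(3) \<open>\<theta> \<le> e\<close> s unfolding s_def by linarith
  next
    case False
    then show ?thesis
      using u'_far[of x] Diff1_deriv_nonzero[OF F] by simp
  qed
  note perturbation = Diff1_perturbation[OF F u u'_cont supp u_bound u'_bound r(3) nz]
  \<comment> \<open>Within half the radius the cutoff is 1, so \<open>F\<close> is replaced entirely
    by the affine map.\<close>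
  have near: "F x + u x = p + s * (x - p)" if "\<bar>x - p\<bar> \<le> r / 2" for x
  proof -
    have "\<bar>(x - p) / r\<bar> \<le> 1/2"
      using that r(1) by (simp add: abs_divide field_simps)
    then show ?thesis
      using \<phi>(9) by (simp add: u_def w_def)
  qed
  show ?thesis
  proof (rule that[OF perturbation(1)])
    show "rho1 F (\<lambda>x. F x + u x) < ereal \<delta>"
      using perturbation(2) e(2) by (meson ereal_less_le less_ereal.simps(1) le_less_trans)
    show "0 < r / 2"
      using r(1) by simp
    fix x assume x: "\<bar>x - p\<bar> \<le> r / 2"
    \<comment> \<open>Slope of absolute value 1 keeps the interval invariant, so the affine formula
      can be applied a second time.\<close>
    have "\<bar>p + s * (x - p) - p\<bar> \<le> r / 2"
      using x s by (simp add: abs_mult s_def)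
    then have "F (F x + u x) + u (F x + u x) = p + s * (s * (x - p))"
      using near[OF x] near[of "p + s * (x - p)"] by simp
    also have "\<dots> = p + (s * s) * (x - p)"
      by simp
    also have "s * s = 1"
      using s abs_mult_self_eq[of s] by (simp add: s_def)
    finally show "F (F x + u x) + u (F x + u x) = x"
      by simp
  qed
qed

text \<open>A bump raises the value at \<open>m\<close>, and the second step must not undo this. If
  \<open>F m\<close> differs from \<open>m\<close>, the second step takes place off the bump; if
  \<open>F\<close> is the identity near \<open>m\<close>, a nonnegative bump only moves the point
  further up.\<close>

lemma bump_perturbation:
  assumes F: "F \<in> Diff1" and "0 < \<rho>"
    and invol: "\<And>x. \<bar>x - m\<bar> < \<rho> \<Longrightarrow> F (F x) = x"
    and m: "F m \<noteq> m \<or> (\<forall>x. \<bar>x - m\<bar> < \<rho> \<longrightarrow> F x = x)" and "0 < \<delta>"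
  obtains G where "G \<in> Diff1" "rho1 F G < ereal \<delta>" "G (G m) \<noteq> m"
proof -
  obtain \<phi> \<phi>' C where \<phi>: "\<And>x. (\<phi> has_real_derivative \<phi>' x) (at x)" "continuous_on UNIV \<phi>'"
    "\<And>x. 0 \<le> \<phi> x" "\<And>x. \<phi> x \<le> 1" "\<And>x. \<bar>\<phi>' x\<bar> \<le> C" "0 < C"
    "\<And>x. 1 \<le> \<bar>x\<bar> \<Longrightarrow> \<phi> x = 0" "\<And>x. 1 \<le> \<bar>x\<bar> \<Longrightarrow> \<phi>' x = 0"
    "\<And>x. \<bar>x\<bar> \<le> 1/2 \<Longrightarrow> \<phi> x = 1"
    by (rule plateau_exists) blast
  \<comment> \<open>Near \<open>m\<close> the derivative of \<open>F\<close> exceeds \<kappa> in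
    absolute value, so a bump of slope at most \<kappa> cannot cancel it.\<close>
  define \<kappa> where "\<kappa> = \<bar>deriv F m\<bar> / 2"
  \<comment> \<open>The available room: the interval where \<open>F\<close> is the identity, or the
    gap between \<open>m\<close> and its image.\<close>
  define t where "t = (if F m = m then \<rho> else \<bar>F m - m\<bar>)"
  define e where "e = \<delta> / 3"
  have pos: "0 < \<kappa>" "0 < t" "0 < e" "2 * e < \<delta>"
    using Diff1_deriv_nonzero[OF F, of m] \<open>0 < \<rho>\<close> \<open>0 < \<delta>\<close> by (auto simp: \<kappa>_def t_def e_def)
  obtain d where d: "0 < d" "\<And>x. \<bar>x - m\<bar> < d \<Longrightarrow> \<bar>deriv F x - deriv F m\<bar> < \<kappa>"
    using Diff1_isCont_deriv[OF F, of m] pos(1) unfolding continuous_at_eps_delta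
    by (auto simp: dist_real_def)
  define r where "r = min (d / 2) (min (e / 2) (t / 3))"
  have r: "0 < r" "r < d" "2 * r \<le> e" "3 * r \<le> t"
    using d(1) pos by (auto simp: r_def)
  \<comment> \<open>The height of the bump: small against its radius, and with slope
    \<open>\<eta> * C / r\<close> at most \<open>min e \<kappa>\<close>.\<close>
  define \<eta> where "\<eta> = min r (r * min e \<kappa> / C)"
  have "0 < \<eta>" "\<eta> \<le> r"
    using r(1) pos \<phi>(6) by (auto simp: \<eta>_def)
  have "\<eta> \<le> r * min e \<kappa> / C"
    by (simp add: \<eta>_def)
  then have \<eta>C: "\<eta> * C / r \<le> min e \<kappa>"
    using r(1) \<phi>(6) by (simp add: pos_divide_le_eq pos_le_divide_eq mult.commute del: min_less_iff_conj min.bounded_iff)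
  define u where "u = (\<lambda>x. \<eta> * \<phi> ((x - m) / r))"
  define u' where "u' = (\<lambda>x. \<eta> * (\<phi>' ((x - m) / r) / r))"
  have u: "(u has_real_derivative u' x) (at x)" for x
  proof -
    have "((\<lambda>x. (x - m) / r) has_real_derivative 1 / r) (at x)"
      using r(1) by (auto intro!: derivative_eq_intros)
    from DERIV_cmult[OF DERIV_chain2[OF \<phi>(1) this]] show ?thesis
      by (simp add: u_def u'_def)
  qed
  have u'_cont: "continuous_on UNIV u'"
  proof -
    have "continuous_on UNIV (\<lambda>x. (x - m) / r)"
      using r(1) by (intro continuous_intros) auto
    with \<phi>(2) have "continuous_on UNIV (\<lambda>x. \<phi>' ((x - m) / r))"
      by (rule continuous_on_compose2) simp
    then show ?thesis
      unfolding u'_def using r(1) by (intro continuous_intros) auto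
  qed
  have far: "1 \<le> \<bar>(x - m) / r\<bar>" if "r < \<bar>x - m\<bar>" for x
    using that r(1) by (simp add: abs_divide)
  have supp: "u x = 0" if "r < \<bar>x - m\<bar>" for x
    using \<phi>(7)[OF far[OF that]] by (simp add: u_def)
  have u'_far: "u' x = 0" if "r < \<bar>x - m\<bar>" for x
    using \<phi>(8)[OF far[OF that]] by (simp add: u'_def)
  have u_nonneg: "0 \<le> u x" for x
    using \<phi>(3) \<open>0 < \<eta>\<close> by (simp add: u_def)
  have "u x \<le> \<eta>" for x
    using \<phi>(4) \<open>0 < \<eta>\<close> by (simp add: u_def mult_left_le)
  then have u_bound: "\<bar>u x\<bar> \<le> e" for x
    using u_nonneg[of x] \<open>\<eta> \<le> r\<close> r(1,3) by (smt (verit))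
  have u'_le: "\<bar>u' x\<bar> \<le> min e \<kappa>" for x
  proof -
    have "\<bar>u' x\<bar> = \<eta> * \<bar>\<phi>' ((x - m) / r)\<bar> / r"
      using \<open>0 < \<eta>\<close> r(1) by (simp add: u'_def abs_mult abs_divide)
    also have "\<dots> \<le> \<eta> * C / r"
      using \<phi>(5) \<open>0 < \<eta>\<close> r(1) by (intro divide_right_mono mult_left_mono) auto
    finally show ?thesis
      using \<eta>C by linarith
  qed
  then have u'_bound: "\<bar>u' x\<bar> \<le> e" for x
    by (meson min.boundedE)
  have nz: "deriv F x + u' x \<noteq> 0" for x
  proof (cases "\<bar>x - m\<bar> \<le> r")
    case True
    then have "\<bar>deriv F x - deriv F m\<bar> < \<kappa>" "\<bar>u' x\<bar> \<le> \<kappa>"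
      using d(2)[of x] r(2) u'_le[of x] by auto
    then show ?thesis
      unfolding \<kappa>_def by (auto simp: abs_if split: if_splits)
  next
    case False
    then show ?thesis
      using u'_far[of x] Diff1_deriv_nonzero[OF F] by simp
  qed
  note perturbation = Diff1_perturbation[OF F u u'_cont supp u_bound u'_bound r(3) nz]
  have um: "u m = \<eta>"
    using \<phi>(9) by (simp add: u_def)
  show ?thesis
  proof (rule that[OF perturbation(1)])
    show "rho1 F (\<lambda>x. F x + u x) < ereal \<delta>"
      using perturbation(2) pos(4) by (meson less_ereal.simps(1) le_less_trans)
    show "F (F m + u m) + u (F m + u m) \<noteq> m"
    proof (cases "F m = m")
      case True
      then have "F (m + \<eta>) = m + \<eta>"
        using m r \<open>0 < \<eta>\<close> \<open>\<eta> \<le> r\<close> by (simp add: t_def)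
      then show ?thesis
        using True um u_nonneg[of "m + \<eta>"] \<open>0 < \<eta>\<close> by simp
    next
      case False
      \<comment> \<open>The gap is at least \<open>3 * r\<close> and \<eta> is at most
        \<open>r\<close>, so the raised image misses the support of \<open>u\<close>. Hence the
        second step is \<open>F\<close> alone, and injectivity separates its value from
        \<open>F (F m) = m\<close>.\<close>
      then have "r < \<bar>F m + \<eta> - m\<bar>"
        using r(1,4) \<open>0 < \<eta>\<close> \<open>\<eta> \<le> r\<close> by (simp add: t_def)
      moreover have "F (F m + \<eta>) \<noteq> F (F m)"
        using Diff1_bij[OF F] \<open>0 < \<eta>\<close> by (simp add: bij_is_inj inj_eq)
      ultimately show ?thesis
        using um supp invol[of m] \<open>0 < \<rho>\<close> by simp
    qed
  qed
qed

subsection \<open>Structural stability\<close>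

lemma structurally_stableD:
  assumes stable: "structurally_stable \<Lambda> f" and "0 < \<epsilon>"
  obtains \<delta> where "0 < \<delta>"
    "\<And>g \<sigma> n. diff1_ifs \<Lambda> g \<Longrightarrow> D1 (f ` \<Lambda>) (g ` \<Lambda>) < ereal \<delta> \<Longrightarrow> range \<sigma> \<subseteq> \<Lambda> \<Longrightarrow>
      \<exists>h k. homeomorphism UNIV UNIV h k \<and>
        (\<forall>x. ifs_comp f \<sigma> n (h x) = h (ifs_comp g \<sigma> n x)) \<and> (\<forall>x. dist x (h x) < \<epsilon>)"
proof -
  note stable_\<epsilon> = stable[unfolded structurally_stable_def fun_eq_iff o_apply,
      THEN spec, THEN mp, OF \<open>0 < \<epsilon>\<close>]
  show ?thesis
    using stable_\<epsilon>
  proof (elim exE conjE)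
    fix \<delta> :: real
    assume \<delta>: "0 < \<delta>" "\<forall>g. diff1_ifs \<Lambda> g \<and> D1 (f ` \<Lambda>) (g ` \<Lambda>) < ereal \<delta> \<longrightarrow>
      (\<forall>\<sigma>. range \<sigma> \<subseteq> \<Lambda> \<longrightarrow> (\<forall>n. \<exists>h k. homeomorphism UNIV UNIV h k \<and>
        (\<forall>x. ifs_comp f \<sigma> n (h x) = h (ifs_comp g \<sigma> n x)) \<and> (\<forall>x. dist x (h x) < \<epsilon>)))"
    show thesis
    proof (rule that[OF \<delta>(1)])
      fix g :: "'a \<Rightarrow> real \<Rightarrow> real" and \<sigma> :: "int \<Rightarrow> 'a" and n :: int
      assume "diff1_ifs \<Lambda> g" "D1 (f ` \<Lambda>) (g ` \<Lambda>) < ereal \<delta>" "range \<sigma> \<subseteq> \<Lambda>"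
      then show "\<exists>h k. homeomorphism UNIV UNIV h k \<and>
        (\<forall>x. ifs_comp f \<sigma> n (h x) = h (ifs_comp g \<sigma> n x)) \<and> (\<forall>x. dist x (h x) < \<epsilon>)"
        using \<delta>(2)[THEN spec, of g] by simp
    qed
  qed
qed

text \<open>Transposing the labels \<open>a\<close> and \<open>b\<close> keeps the set of maps, so
  \<open>D1\<close> is 0 and the same system \<open>g\<close> is admissible for every \<epsilon>.
  Letting \<epsilon> tend to 0, continuity of \<open>f a\<close> identifies the two maps.\<close>

lemma structurally_stable_all_equal:
  assumes ifs: "diff1_ifs \<Lambda> f" and stable: "structurally_stable \<Lambda> f" and ab: "a \<in> \<Lambda>" "b \<in> \<Lambda>"
  shows "f a = f b"
proof
  fix x
  define g where "g = f \<circ> Transposition.transpose a b"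
  have img: "g ` \<Lambda> = f ` \<Lambda>"
    using ab unfolding g_def image_comp[symmetric] by simp
  have g: "diff1_ifs \<Lambda> g"
    using ifs img unfolding diff1_ifs_def by (metis imageE imageI)
  have ga: "g a = f b"
    by (simp add: g_def)
  \<comment> \<open>The witness is \<open>h x\<close>: along the constant sequence \<open>a\<close>
    with n = 1 the conjugacy reads \<open>f a (h x) = h (f b x)\<close>, and \<open>h\<close> moves
    every point by less than \<open>e\<close>.\<close>
  have close: "\<exists>y. dist x y < e \<and> dist (f b x) (f a y) < e" if "0 < e" for e
  proof -
    obtain d where d: "0 < d"
      "\<And>g \<sigma> n. diff1_ifs \<Lambda> g \<Longrightarrow> D1 (f ` \<Lambda>) (g ` \<Lambda>) < ereal d \<Longrightarrow> range \<sigma> \<subseteq> \<Lambda> \<Longrightarrow>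
        \<exists>h k. homeomorphism UNIV UNIV h k \<and>
          (\<forall>x. ifs_comp f \<sigma> n (h x) = h (ifs_comp g \<sigma> n x)) \<and> (\<forall>x. dist x (h x) < e)"
      by (fact structurally_stableD[OF stable \<open>0 < e\<close>])
    have "D1 (f ` \<Lambda>) (g ` \<Lambda>) < ereal d"
      using d(1) by (simp add: D1_def img)
    then obtain h where h: "\<And>x. ifs_comp f (\<lambda>_. a) 1 (h x) = h (ifs_comp g (\<lambda>_. a) 1 x)"
      "\<And>x. dist x (h x) < e"
      using d(2)[of g "\<lambda>_. a" 1] g ab(1) by auto
    have "f a (h x) = h (f b x)"
      using h(1)[of x] ga by (simp add: ifs_comp_def)
    then show ?thesis
      using h(2) by metis
  qed
  show "f a x = f b x"
  proof (rule ccontr)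
    define e where "e = dist (f a x) (f b x) / 2"
    assume "f a x \<noteq> f b x"
    then have "0 < e"
      by (simp add: e_def)
    have "isCont (f a) x"
      using ifs ab(1) by (auto simp: diff1_ifs_def intro: Diff1_isCont)
    then obtain d where "0 < d" and d: "\<And>y. dist y x < d \<Longrightarrow> dist (f a y) (f a x) < e"
      using \<open>0 < e\<close> unfolding continuous_at_eps_delta by blast
    obtain y where y: "dist x y < min d e" "dist (f b x) (f a y) < min d e"
      using close[of "min d e"] \<open>0 < d\<close> \<open>0 < e\<close> by auto
    have "dist (f a x) (f b x) \<le> dist (f a y) (f a x) + dist (f b x) (f a y)"
      by (metis add.commute dist_commute dist_triangle)
    also have "\<dots> < e + e"
      using d[of y] y by (intro add_strict_mono) (simp_all add: dist_commute)
    finally show False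
      by (simp add: e_def)
  qed
qed

text \<open>\<open>D1\<close> compares all pairs of maps, but the stable system consists of the
  single map \<open>f l\<close>. Replacing every map by \<open>G\<close> therefore costs
  \<open>rho1 (f l) G\<close>, or 0 if the two maps coincide.\<close>

lemma structurally_stable_square:
  assumes ifs: "diff1_ifs \<Lambda> f" and stable: "structurally_stable \<Lambda> f" and l: "l \<in> \<Lambda>"
    and "0 < \<epsilon>"
  obtains \<delta> where "0 < \<delta>"
    "\<And>G. G \<in> Diff1 \<Longrightarrow> rho1 (f l) G < ereal \<delta> \<Longrightarrow>
      \<exists>h k. homeomorphism UNIV UNIV h k \<and> (\<forall>x. f l (f l (h x)) = h (G (G x))) \<and>
        (\<forall>x. dist x (h x) < \<epsilon>)"
proof -
  obtain d where d: "0 < d"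
    "\<And>g \<sigma> n. diff1_ifs \<Lambda> g \<Longrightarrow> D1 (f ` \<Lambda>) (g ` \<Lambda>) < ereal d \<Longrightarrow> range \<sigma> \<subseteq> \<Lambda> \<Longrightarrow>
      \<exists>h k. homeomorphism UNIV UNIV h k \<and>
        (\<forall>x. ifs_comp f \<sigma> n (h x) = h (ifs_comp g \<sigma> n x)) \<and> (\<forall>x. dist x (h x) < \<epsilon>)"
    by (fact structurally_stableD[OF stable \<open>0 < \<epsilon>\<close>])
  show ?thesis
  proof (rule that[OF d(1)])
    fix G assume G: "G \<in> Diff1" "rho1 (f l) G < ereal d"
    have "f ` \<Lambda> = (\<lambda>_. f l) ` \<Lambda>"
      by (intro image_cong refl structurally_stable_all_equal[OF ifs stable _ l])
    then have "f ` \<Lambda> = {f l}"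
      by (simp only: image_constant[OF l])
    moreover have "(\<lambda>_. G) ` \<Lambda> = {G}"
      using l by auto
    ultimately have "D1 (f ` \<Lambda>) ((\<lambda>_. G) ` \<Lambda>) < ereal d"
      using G(2) d(1) by (simp add: D1_def)
    moreover have "diff1_ifs \<Lambda> (\<lambda>_. G)"
      using ifs G(1) by (simp add: diff1_ifs_def)
    \<comment> \<open>The constant sequence with n = 2 yields the squares; squaring treats the
      multipliers 1 and -1 alike.\<close>
    ultimately obtain h k where hk: "homeomorphism UNIV UNIV h k"
      "\<And>x. ifs_comp f (\<lambda>_. l) 2 (h x) = h (ifs_comp (\<lambda>_. G) (\<lambda>_. l) 2 x)" "\<forall>x. dist x (h x) < \<epsilon>"
      using d(2)[of "\<lambda>_. G" "\<lambda>_. l" 2] l by auto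
    have "f l (f l (h x)) = h (G (G x))" for x
      using hk(2)[of x] by (simp add: ifs_comp_def numeral_2_eq_2)
    with hk(1,3) show "\<exists>h k. homeomorphism UNIV UNIV h k \<and>
        (\<forall>x. f l (f l (h x)) = h (G (G x))) \<and> (\<forall>x. dist x (h x) < \<epsilon>)"
      by blast
  qed
qed

theorem theorem15:
  fixes \<Lambda> :: "'l set" and f :: "'l \<Rightarrow> real \<Rightarrow> real"
  assumes "diff1_ifs \<Lambda> f"
    and "structurally_stable \<Lambda> f"
  shows "\<forall>l\<in>\<Lambda>. \<forall>p. f l p = p \<longrightarrow> hyperbolic_fixed_point (f l) p"
proof (intro ballI allI impI)
  fix l p assume l: "l \<in> \<Lambda>" and p: "f l p = p"
  have F: "f l \<in> Diff1"
    using assms(1) l by (simp add: diff1_ifs_def)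
  have "\<bar>deriv (f l) p\<bar> \<noteq> 1"
  proof
    assume s: "\<bar>deriv (f l) p\<bar> = 1"
    define P where "P = {x. f l (f l x) = x}"
    \<comment> \<open>The bound 1 is arbitrary: this conjugacy only has to be a
      homeomorphism.\<close>
    obtain \<delta> where \<delta>: "0 < \<delta>" "\<And>G. G \<in> Diff1 \<Longrightarrow> rho1 (f l) G < ereal \<delta> \<Longrightarrow>
        \<exists>h k. homeomorphism UNIV UNIV h k \<and> (\<forall>x. f l (f l (h x)) = h (G (G x))) \<and>
          (\<forall>x. dist x (h x) < 1)"
      by (fact structurally_stable_square[OF assms l zero_less_one])
    obtain G r where G: "G \<in> Diff1" "rho1 (f l) G < ereal \<delta>" "0 < r"
      "\<And>x. \<bar>x - p\<bar> \<le> r \<Longrightarrow> G (G x) = x"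
      by (rule affine_perturbation[OF F p s \<delta>(1)]) blast
    obtain h k where hk: "homeomorphism UNIV UNIV h k" "\<And>x. f l (f l (h x)) = h (G (G x))"
      using \<delta>(2)[OF G(1,2)] by blast
    \<comment> \<open>The conjugacy carries the ball fixed pointwise by the square of
      \<open>G\<close> to an open set fixed pointwise by the square of \<open>f l\<close>.\<close>
    have "open (h ` ball p r)"
      using homeomorphism_imp_open_map[OF hk(1), of "ball p r"] by simp
    moreover have "h ` ball p r \<subseteq> P"
      using G(4) hk(2) by (auto simp: P_def dist_real_def abs_minus_commute)
    ultimately have int_P: "h p \<in> interior P"
      using G(3) by (intro interiorI[of "h ` ball p r"]) auto
    \<comment> \<open>Take an interior point moved by \<open>f l\<close> if there is one; otherwise
      \<open>h p\<close> serves, since \<open>f l\<close> is the identity on the interior.\<close>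
    obtain m where m: "m \<in> interior P" "f l m \<noteq> m \<or> (\<forall>x\<in>interior P. f l x = x)"
      using int_P by blast
    obtain \<rho> where \<rho>: "0 < \<rho>" "ball m \<rho> \<subseteq> interior P"
      using m(1) open_contains_ball[of "interior P"] by auto
    have near: "x \<in> interior P" if "\<bar>x - m\<bar> < \<rho>" for x
      using that \<rho>(2) by (auto simp: dist_real_def abs_minus_commute)
    have invol: "f l (f l x) = x" if "\<bar>x - m\<bar> < \<rho>" for x
      using near[OF that] interior_subset[of P] by (auto simp: P_def)
    obtain \<delta>' where \<delta>': "0 < \<delta>'" "\<And>G. G \<in> Diff1 \<Longrightarrow> rho1 (f l) G < ereal \<delta>' \<Longrightarrow>
        \<exists>h k. homeomorphism UNIV UNIV h k \<and> (\<forall>x. f l (f l (h x)) = h (G (G x))) \<and>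
          (\<forall>x. dist x (h x) < \<rho>)"
      by (fact structurally_stable_square[OF assms l \<rho>(1)])
    have "f l m \<noteq> m \<or> (\<forall>x. \<bar>x - m\<bar> < \<rho> \<longrightarrow> f l x = x)"
      using m(2) near by blast
    then obtain H where H: "H \<in> Diff1" "rho1 (f l) H < ereal \<delta>'" "H (H m) \<noteq> m"
      using bump_perturbation[OF F \<rho>(1) invol _ \<delta>'(1)] by blast
    obtain h' k' where h': "homeomorphism UNIV UNIV h' k'"
      "\<And>x. f l (f l (h' x)) = h' (H (H x))" "\<And>x. dist x (h' x) < \<rho>"
      using \<delta>'(2)[OF H(1,2)] by blast
    \<comment> \<open>The closeness \<rho> keeps \<open>h' m\<close> in the ball around
      \<open>m\<close>, where the square of \<open>f l\<close> is the identity.\<close>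
    have "h' (H (H m)) = h' m"
      using h'(2)[of m] invol[of "h' m"] h'(3)[of m] by (simp add: dist_real_def abs_minus_commute)
    then have "H (H m) = m"
      using h'(1) by (metis UNIV_I homeomorphism_apply1)
    then show False
      using H(3) by contradiction
  qed
  then show "hyperbolic_fixed_point (f l) p"
    using p by (simp add: hyperbolic_fixed_point_def)
qed

end
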